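(* Let $\mathcal{C}$ be a category with finite products and let $\mathsf{M}=(M,\,m\colon M\times M\to M,\,e\colon 1\to M)$ be a monoid in $\mathcal{C}$. Let $C$ be an object of $\mathcal{C}$. Then the assignment $(f\colon C\to M)\mapsto \langle \mathrm{id}_C,f\rangle^\sharp$ defines a map $E_C\colon \mathcal{C}(C,M)\to \mathcal{C}_{\mathsf{M}}(F_{\mathsf{M}}C,F_{\mathsf{M}}C)$ such that the following hold. 1. $E_C$ is a monoid morphism from the convolution monoid $(\mathcal{C}(C,M),\ast,e_C)$ into the $\mathcal{C}_{\mathsf{M}}$-endomorphism monoid of $F_{\mathsf{M}}C$ (with composition as multiplication). 2. $E_C$ is a section (i.e. the map $E_C$ has a left inverse). 3. If $\mathsf{M}$ even is a group in $\mathcal{C}$ then, for each $f\colon C\to M$, the endomorphism $E_C(f)$ is an automorphism.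
   Context: Convolution monoid: for an object $C$, the set $\mathcal{C}(C,M)$ is a monoid with unit $e_C = (C\xrightarrow{!}1\xrightarrow{e}M)$ and multiplication $\phi\ast\psi = (C\xrightarrow{\Delta_C}C\times C\xrightarrow{\phi\times\psi}M\times M\xrightarrow{m}M)$. $\mathcal{C}_{\mathsf{M}}$ is the category of (right) $\mathsf{M}$-acts $(C,\alpha\colon C\times M\to C)$ in $\mathcal{C}$ (satisfying the usual unit and associativity axioms) and action-preserving morphisms. Its forgetful functor $|-|$ to $\mathcal{C}$ has a left adjoint $F_{\mathsf{M}}$, where $F_{\mathsf{M}}C$ is the object $C\times M$ with action $\mathrm{id}_C\times m\colon C\times M\times M\to C\times M$, and with unit $\eta_C=(C\simeq C\times 1\xrightarrow{\mathrm{id}_C\times e}C\times M)$. For a $\mathcal{C}$-morphism $g\colon C\to Y\times M$, $g^\sharp\colon F_{\mathsf{M}}C\to F_{\mathsf{M}}Y$ denotes its homomorphic extension, i.e. the unique $\mathsf{M}$-act morphism with $g^\sharp\circ\eta_C=g$; its underlying $\mathcal{C}$-morphism is $C\times M\xrightarrow{g\times \mathrm{id}_M}Y\times M\times M\xrightarrow{\mathrm{id}_Y\times m}Y\times M$. The morphism $\langle \mathrm{id}_C,f\rangle\colon C\to C\times M$ is the one with components $\mathrm{id}_C$ and $f$. *)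

theory Defs
  imports "HOL-Algebra.Group"
begin

record ('o, 'm) category =
  Obj :: "'o set"
  Arr :: "'m set"
  Dom :: "'m \<Rightarrow> 'o"
  Cod :: "'m \<Rightarrow> 'o"
  Id :: "'o \<Rightarrow> 'm"
  Comp :: "'m \<Rightarrow> 'm \<Rightarrow> 'm"  (infixr "\<cdot>\<index>" 70)

definition Hom :: "('o, 'm, 'z) category_scheme \<Rightarrow> 'o \<Rightarrow> 'o \<Rightarrow> 'm set"
  where "Hom \<C> A B = {f \<in> Arr \<C>. Dom \<C> f = A \<and> Cod \<C> f = B}"

locale category =
  fixes \<C> :: "('o, 'm, 'z) category_scheme" (structure)
  assumes Dom_Obj: "f \<in> Arr \<C> \<Longrightarrow> Dom \<C> f \<in> Obj \<C>"
    and Cod_Obj: "f \<in> Arr \<C> \<Longrightarrow> Cod \<C> f \<in> Obj \<C>"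
    and Id_Hom: "A \<in> Obj \<C> \<Longrightarrow> Id \<C> A \<in> Hom \<C> A A"
    and Comp_Hom: "f \<in> Hom \<C> A B \<Longrightarrow> g \<in> Hom \<C> B D \<Longrightarrow> g \<cdot> f \<in> Hom \<C> A D"
    and Id_left: "f \<in> Hom \<C> A B \<Longrightarrow> Id \<C> B \<cdot> f = f"
    and Id_right: "f \<in> Hom \<C> A B \<Longrightarrow> f \<cdot> Id \<C> A = f"
    and Comp_assoc: "f \<in> Hom \<C> A B \<Longrightarrow> g \<in> Hom \<C> B D \<Longrightarrow> h \<in> Hom \<C> D E
      \<Longrightarrow> (h \<cdot> g) \<cdot> f = h \<cdot> (g \<cdot> f)"

definition isomorphism :: "('o, 'm, 'z) category_scheme \<Rightarrow> 'o \<Rightarrow> 'o \<Rightarrow> 'm \<Rightarrow> bool"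
  where "isomorphism \<C> A B f \<longleftrightarrow> f \<in> Hom \<C> A B \<and>
    (\<exists>g \<in> Hom \<C> B A. g \<cdot>\<^bsub>\<C>\<^esub> f = Id \<C> A \<and> f \<cdot>\<^bsub>\<C>\<^esub> g = Id \<C> B)"

abbreviation automorphism :: "('o, 'm, 'z) category_scheme \<Rightarrow> 'o \<Rightarrow> 'm \<Rightarrow> bool"
  where "automorphism \<C> A f \<equiv> isomorphism \<C> A A f"

definition End_monoid :: "('o, 'm, 'z) category_scheme \<Rightarrow> 'o \<Rightarrow> 'm monoid"
  where "End_monoid \<C> A = \<lparr>carrier = Hom \<C> A A, mult = Comp \<C>, one = Id \<C> A\<rparr>"

text \<open>An arbitrary choice of a terminal object and of binary products is part of the structure.\<close>

record ('o, 'm) fp_category = "('o, 'm) category" +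
  One :: "'o"
  Prod :: "'o \<Rightarrow> 'o \<Rightarrow> 'o"  (infixr "\<^bold>\<times>\<index>" 75)
  Fst :: "'o \<Rightarrow> 'o \<Rightarrow> 'm"
  Snd :: "'o \<Rightarrow> 'o \<Rightarrow> 'm"

locale fp_category = category \<C>
  for \<C> :: "('o, 'm, 'z) fp_category_scheme" (structure) +
  assumes One_Obj: "One \<C> \<in> Obj \<C>"
    and terminal: "A \<in> Obj \<C> \<Longrightarrow> \<exists>!f. f \<in> Hom \<C> A (One \<C>)"
    and Prod_Obj: "A \<in> Obj \<C> \<Longrightarrow> B \<in> Obj \<C> \<Longrightarrow> A \<^bold>\<times> B \<in> Obj \<C>"
    and Fst_Hom: "A \<in> Obj \<C> \<Longrightarrow> B \<in> Obj \<C> \<Longrightarrow> Fst \<C> A B \<in> Hom \<C> (A \<^bold>\<times> B) A"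
    and Snd_Hom: "A \<in> Obj \<C> \<Longrightarrow> B \<in> Obj \<C> \<Longrightarrow> Snd \<C> A B \<in> Hom \<C> (A \<^bold>\<times> B) B"
    and product: "f \<in> Hom \<C> X A \<Longrightarrow> g \<in> Hom \<C> X B \<Longrightarrow>
      \<exists>!h. h \<in> Hom \<C> X (A \<^bold>\<times> B) \<and> Fst \<C> A B \<cdot> h = f \<and> Snd \<C> A B \<cdot> h = g"

definition Bang :: "('o, 'm, 'z) fp_category_scheme \<Rightarrow> 'o \<Rightarrow> 'm"
  where "Bang \<C> A = (THE f. f \<in> Hom \<C> A (One \<C>))"

text \<open>\<open>Tuple \<C> f g\<close> is $\langle f, g\rangle$; it is meaningful only if \<open>f\<close> and \<open>g\<close> have the same domain.\<close>

definition Tuple :: "('o, 'm, 'z) fp_category_scheme \<Rightarrow> 'm \<Rightarrow> 'm \<Rightarrow> 'm"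
  where "Tuple \<C> f g = (let A = Cod \<C> f; B = Cod \<C> g in
    THE h. h \<in> Hom \<C> (Dom \<C> f) (A \<^bold>\<times>\<^bsub>\<C>\<^esub> B) \<and>
      Fst \<C> A B \<cdot>\<^bsub>\<C>\<^esub> h = f \<and> Snd \<C> A B \<cdot>\<^bsub>\<C>\<^esub> h = g)"

definition Times :: "('o, 'm, 'z) fp_category_scheme \<Rightarrow> 'm \<Rightarrow> 'm \<Rightarrow> 'm"  (infixr "\<boxtimes>\<index>" 75)
  where "f \<boxtimes>\<^bsub>\<C>\<^esub> g = Tuple \<C> (f \<cdot>\<^bsub>\<C>\<^esub> Fst \<C> (Dom \<C> f) (Dom \<C> g)) (g \<cdot>\<^bsub>\<C>\<^esub> Snd \<C> (Dom \<C> f) (Dom \<C> g))"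

definition Diag :: "('o, 'm, 'z) fp_category_scheme \<Rightarrow> 'o \<Rightarrow> 'm"
  where "Diag \<C> A = Tuple \<C> (Id \<C> A) (Id \<C> A)"

text \<open>The canonical isomorphism $(A \times B) \times D \to A \times (B \times D)$.\<close>

definition Assoc :: "('o, 'm, 'z) fp_category_scheme \<Rightarrow> 'o \<Rightarrow> 'o \<Rightarrow> 'o \<Rightarrow> 'm"
  where "Assoc \<C> A B D = Tuple \<C>
    (Fst \<C> A B \<cdot>\<^bsub>\<C>\<^esub> Fst \<C> (A \<^bold>\<times>\<^bsub>\<C>\<^esub> B) D)
    (Snd \<C> A B \<boxtimes>\<^bsub>\<C>\<^esub> Id \<C> D)"

record ('o, 'm) monoid_object =
  Carr :: "'o"
  Mul :: "'m"
  Unt :: "'m"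

locale monoid_object = fp_category \<C>
  for \<C> :: "('o, 'm, 'z) fp_category_scheme" (structure) +
  fixes M :: "('o, 'm) monoid_object"
  assumes Carr_Obj: "Carr M \<in> Obj \<C>"
    and Mul_Hom: "Mul M \<in> Hom \<C> (Carr M \<^bold>\<times> Carr M) (Carr M)"
    and Unt_Hom: "Unt M \<in> Hom \<C> (One \<C>) (Carr M)"
    and Mul_assoc: "Mul M \<cdot> (Mul M \<boxtimes> Id \<C> (Carr M)) =
      Mul M \<cdot> (Id \<C> (Carr M) \<boxtimes> Mul M) \<cdot> Assoc \<C> (Carr M) (Carr M) (Carr M)"
    and Unt_left: "Mul M \<cdot> (Unt M \<boxtimes> Id \<C> (Carr M)) = Snd \<C> (One \<C>) (Carr M)"
    and Unt_right: "Mul M \<cdot> (Id \<C> (Carr M) \<boxtimes> Unt M) = Fst \<C> (Carr M) (One \<C>)"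

locale group_object = monoid_object +
  assumes inverse: "\<exists>i \<in> Hom \<C> (Carr M) (Carr M).
    Mul M \<cdot> (i \<boxtimes> Id \<C> (Carr M)) \<cdot> Diag \<C> (Carr M) = Unt M \<cdot> Bang \<C> (Carr M) \<and>
    Mul M \<cdot> (Id \<C> (Carr M) \<boxtimes> i) \<cdot> Diag \<C> (Carr M) = Unt M \<cdot> Bang \<C> (Carr M)"

definition Conv_monoid ::
    "('o, 'm, 'z) fp_category_scheme \<Rightarrow> ('o, 'm) monoid_object \<Rightarrow> 'o \<Rightarrow> 'm monoid"
  where "Conv_monoid \<C> M C = \<lparr>carrier = Hom \<C> C (Carr M),
    mult = (\<lambda>\<phi> \<psi>. Mul M \<cdot>\<^bsub>\<C>\<^esub> (\<phi> \<boxtimes>\<^bsub>\<C>\<^esub> \<psi>) \<cdot>\<^bsub>\<C>\<^esub> Diag \<C> C),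
    one = Unt M \<cdot>\<^bsub>\<C>\<^esub> Bang \<C> C\<rparr>"

definition is_act ::
    "('o, 'm, 'z) fp_category_scheme \<Rightarrow> ('o, 'm) monoid_object \<Rightarrow> 'o \<times> 'm \<Rightarrow> bool"
  where "is_act \<C> M = (\<lambda>(A, \<alpha>). A \<in> Obj \<C> \<and> \<alpha> \<in> Hom \<C> (A \<^bold>\<times>\<^bsub>\<C>\<^esub> Carr M) A \<and>
    \<alpha> \<cdot>\<^bsub>\<C>\<^esub> (Id \<C> A \<boxtimes>\<^bsub>\<C>\<^esub> Unt M) = Fst \<C> A (One \<C>) \<and>
    \<alpha> \<cdot>\<^bsub>\<C>\<^esub> (\<alpha> \<boxtimes>\<^bsub>\<C>\<^esub> Id \<C> (Carr M)) =
      \<alpha> \<cdot>\<^bsub>\<C>\<^esub> (Id \<C> A \<boxtimes>\<^bsub>\<C>\<^esub> Mul M) \<cdot>\<^bsub>\<C>\<^esub> Assoc \<C> A (Carr M) (Carr M))"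

definition is_act_morphism ::
    "('o, 'm, 'z) fp_category_scheme \<Rightarrow> ('o, 'm) monoid_object \<Rightarrow> 'o \<times> 'm \<Rightarrow> 'o \<times> 'm \<Rightarrow> 'm \<Rightarrow> bool"
  where "is_act_morphism \<C> M = (\<lambda>(A, \<alpha>) (B, \<beta>) h. h \<in> Hom \<C> A B \<and>
    h \<cdot>\<^bsub>\<C>\<^esub> \<alpha> = \<beta> \<cdot>\<^bsub>\<C>\<^esub> (h \<boxtimes>\<^bsub>\<C>\<^esub> Id \<C> (Carr M)))"

text \<open>The arrows are triples consisting of source act, underlying morphism and target act, since
  the underlying morphism does not determine the actions.\<close>

type_synonym ('o, 'm) act_arrow = "('o \<times> 'm) \<times> 'm \<times> ('o \<times> 'm)"

abbreviation underlying :: "('o, 'm) act_arrow \<Rightarrow> 'm"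
  where "underlying k \<equiv> fst (snd k)"

definition Acts :: "('o, 'm, 'z) fp_category_scheme \<Rightarrow> ('o, 'm) monoid_object \<Rightarrow>
    ('o \<times> 'm, ('o, 'm) act_arrow) category"
  where "Acts \<C> M = \<lparr>Obj = {X. is_act \<C> M X},
    Arr = {(X, h, Y). is_act \<C> M X \<and> is_act \<C> M Y \<and> is_act_morphism \<C> M X Y h},
    Dom = (\<lambda>(X, h, Y). X),
    Cod = (\<lambda>(X, h, Y). Y),
    Id = (\<lambda>X. (X, Id \<C> (fst X), X)),
    Comp = (\<lambda>(Y', k, Z) (X, h, Y). (X, k \<cdot>\<^bsub>\<C>\<^esub> h, Z))\<rparr>"

definition Free_act ::
    "('o, 'm, 'z) fp_category_scheme \<Rightarrow> ('o, 'm) monoid_object \<Rightarrow> 'o \<Rightarrow> 'o \<times> 'm"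
  where "Free_act \<C> M C = (C \<^bold>\<times>\<^bsub>\<C>\<^esub> Carr M,
    (Id \<C> C \<boxtimes>\<^bsub>\<C>\<^esub> Mul M) \<cdot>\<^bsub>\<C>\<^esub> Assoc \<C> C (Carr M) (Carr M))"

definition Free_unit ::
    "('o, 'm, 'z) fp_category_scheme \<Rightarrow> ('o, 'm) monoid_object \<Rightarrow> 'o \<Rightarrow> 'm"
  where "Free_unit \<C> M C = (Id \<C> C \<boxtimes>\<^bsub>\<C>\<^esub> Unt M) \<cdot>\<^bsub>\<C>\<^esub> Tuple \<C> (Id \<C> C) (Bang \<C> C)"

text \<open>For $g \colon C \to Y \times M$, \<open>Sharp \<C> M C Y g\<close> is the homomorphic extension
  $g^\sharp \colon F_M C \to F_M Y$. Existence and uniqueness are lemma \<open>Sharp_unique_existence\<close>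
  below, and the explicit description of $g^\sharp$ is \<open>Sharp_eq\<close>.\<close>

definition Sharp :: "('o, 'm, 'z) fp_category_scheme \<Rightarrow> ('o, 'm) monoid_object \<Rightarrow>
    'o \<Rightarrow> 'o \<Rightarrow> 'm \<Rightarrow> ('o, 'm) act_arrow"
  where "Sharp \<C> M C Y g =
    (THE k. k \<in> Hom (Acts \<C> M) (Free_act \<C> M C) (Free_act \<C> M Y) \<and>
      underlying k \<cdot>\<^bsub>\<C>\<^esub> Free_unit \<C> M C = g)"

definition E_map :: "('o, 'm, 'z) fp_category_scheme \<Rightarrow> ('o, 'm) monoid_object \<Rightarrow>
    'o \<Rightarrow> 'm \<Rightarrow> ('o, 'm) act_arrow"
  where "E_map \<C> M C f = Sharp \<C> M C C (Tuple \<C> (Id \<C> C) f)"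

text \<open>\<^const>\<open>hom\<close> only requires compatibility with the multiplication.\<close>

definition monoid_morphism ::
    "('a, 'x) monoid_scheme \<Rightarrow> ('b, 'y) monoid_scheme \<Rightarrow> ('a \<Rightarrow> 'b) \<Rightarrow> bool"
  where "monoid_morphism A B h \<longleftrightarrow>
    monoid A \<and> monoid B \<and> h \<in> hom A B \<and> h \<one>\<^bsub>A\<^esub> = \<one>\<^bsub>B\<^esub>"


context category
begin

lemma HomD:
  assumes "f \<in> Hom \<C> A B"
  shows "f \<in> Arr \<C>" "Dom \<C> f = A" "Cod \<C> f = B" "A \<in> Obj \<C>" "B \<in> Obj \<C>"
  using assms Dom_Obj Cod_Obj by (auto simp: Hom_def)

end

context fp_category
begin

lemma Bang_Hom: "A \<in> Obj \<C> \<Longrightarrow> Bang \<C> A \<in> Hom \<C> A (One \<C>)"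
  unfolding Bang_def by (rule theI') (rule terminal)

lemma Bang_eq: "f \<in> Hom \<C> A (One \<C>) \<Longrightarrow> f = Bang \<C> A"
  using terminal Bang_Hom HomD by metis

lemma Tuple:
  assumes "f \<in> Hom \<C> X A" "g \<in> Hom \<C> X B"
  shows Tuple_Hom: "Tuple \<C> f g \<in> Hom \<C> X (A \<^bold>\<times> B)"
    and Fst_Tuple: "Fst \<C> A B \<cdot> Tuple \<C> f g = f"
    and Snd_Tuple: "Snd \<C> A B \<cdot> Tuple \<C> f g = g"
  using theI'[OF product[OF assms]] unfolding Tuple_def Let_def
  by (simp_all add: HomD[OF assms(1)] HomD[OF assms(2)])

lemma Tuple_eqI:
  assumes "h \<in> Hom \<C> X (A \<^bold>\<times> B)" "A \<in> Obj \<C>" "B \<in> Obj \<C>"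
    "Fst \<C> A B \<cdot> h = f" "Snd \<C> A B \<cdot> h = g"
  shows "h = Tuple \<C> f g"
proof -
  have f: "f \<in> Hom \<C> X A" and g: "g \<in> Hom \<C> X B"
    using assms Comp_Hom Fst_Hom Snd_Hom by blast+
  show ?thesis using product[OF f g] assms Tuple[OF f g] by blast
qed

lemma Tuple_Comp:
  assumes "f \<in> Hom \<C> X A" "g \<in> Hom \<C> X B" "h \<in> Hom \<C> Y X"
  shows "Tuple \<C> f g \<cdot> h = Tuple \<C> (f \<cdot> h) (g \<cdot> h)"
proof -
  have o: "A \<in> Obj \<C>" "B \<in> Obj \<C>" using assms HomD by blast+
  show ?thesis
    using o Comp_assoc[OF assms(3) Tuple_Hom[OF assms(1,2)] Fst_Hom[OF o]]
      Comp_assoc[OF assms(3) Tuple_Hom[OF assms(1,2)] Snd_Hom[OF o]]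
    by (intro Tuple_eqI[where X = Y and A = A and B = B])
      (simp_all add: Comp_Hom[OF assms(3) Tuple_Hom[OF assms(1,2)]] Fst_Tuple[OF assms(1,2)]
        Snd_Tuple[OF assms(1,2)])
qed

lemma Tuple_eta:
  assumes "h \<in> Hom \<C> X (A \<^bold>\<times> B)" "A \<in> Obj \<C>" "B \<in> Obj \<C>"
  shows "Tuple \<C> (Fst \<C> A B \<cdot> h) (Snd \<C> A B \<cdot> h) = h"
  using Tuple_eqI[OF assms refl refl] by simp

lemma Times_Hom:
  assumes "f \<in> Hom \<C> A A'" "g \<in> Hom \<C> B B'"
  shows "f \<boxtimes> g \<in> Hom \<C> (A \<^bold>\<times> B) (A' \<^bold>\<times> B')"
proof -
  note d = HomD[OF assms(1)] HomD[OF assms(2)]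
  show ?thesis unfolding Times_def using d
    by (simp add: Tuple_Hom[OF Comp_Hom[OF Fst_Hom assms(1)] Comp_Hom[OF Snd_Hom assms(2)]])
qed

lemma Times_Tuple:
  assumes "f \<in> Hom \<C> A A'" "g \<in> Hom \<C> B B'" "h \<in> Hom \<C> X A" "k \<in> Hom \<C> X B"
  shows "(f \<boxtimes> g) \<cdot> Tuple \<C> h k = Tuple \<C> (f \<cdot> h) (g \<cdot> k)"
proof -
  note d = HomD[OF assms(1)] HomD[OF assms(2)]
  have o: "A \<in> Obj \<C>" "B \<in> Obj \<C>" using d by auto
  have t: "Tuple \<C> h k \<in> Hom \<C> X (A \<^bold>\<times> B)" using Tuple_Hom assms by blast
  show ?thesis unfolding Times_def
    using Tuple_Comp[OF Comp_Hom[OF Fst_Hom[OF o] assms(1)] Comp_Hom[OF Snd_Hom[OF o] assms(2)] t]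
      Comp_assoc[OF t Fst_Hom[OF o] assms(1)] Comp_assoc[OF t Snd_Hom[OF o] assms(2)]
    by (simp add: d Fst_Tuple[OF assms(3,4)] Snd_Tuple[OF assms(3,4)])
qed

lemma Assoc_Hom:
  assumes o: "A \<in> Obj \<C>" "B \<in> Obj \<C>" "D \<in> Obj \<C>"
  shows "Assoc \<C> A B D \<in> Hom \<C> ((A \<^bold>\<times> B) \<^bold>\<times> D) (A \<^bold>\<times> (B \<^bold>\<times> D))"
  unfolding Assoc_def
  by (intro Tuple_Hom Times_Hom Comp_Hom[OF Fst_Hom Fst_Hom] Snd_Hom Id_Hom Prod_Obj o)

lemma Assoc_Tuple:
  assumes "a \<in> Hom \<C> X A" "b \<in> Hom \<C> X B" "d \<in> Hom \<C> X D"
  shows "Assoc \<C> A B D \<cdot> Tuple \<C> (Tuple \<C> a b) d = Tuple \<C> a (Tuple \<C> b d)"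
proof -
  have o: "A \<in> Obj \<C>" "B \<in> Obj \<C>" "D \<in> Obj \<C>" using assms HomD by blast+
  have ab: "Tuple \<C> a b \<in> Hom \<C> X (A \<^bold>\<times> B)" using assms Tuple_Hom by blast
  have t: "Tuple \<C> (Tuple \<C> a b) d \<in> Hom \<C> X ((A \<^bold>\<times> B) \<^bold>\<times> D)" using ab assms Tuple_Hom by blast
  have F: "Fst \<C> (A \<^bold>\<times> B) D \<in> Hom \<C> ((A \<^bold>\<times> B) \<^bold>\<times> D) (A \<^bold>\<times> B)" using Fst_Hom[OF Prod_Obj[OF o(1,2)] o(3)] .
  have S: "Snd \<C> A B \<boxtimes> Id \<C> D \<in> Hom \<C> ((A \<^bold>\<times> B) \<^bold>\<times> D) (B \<^bold>\<times> D)"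
    using Times_Hom[OF Snd_Hom[OF o(1,2)] Id_Hom[OF o(3)]] .
  have 1: "(Fst \<C> A B \<cdot> Fst \<C> (A \<^bold>\<times> B) D) \<cdot> Tuple \<C> (Tuple \<C> a b) d = a"
    using Comp_assoc[OF t F Fst_Hom[OF o(1,2)]] Fst_Tuple[OF ab assms(3)] Fst_Tuple[OF assms(1,2)]
    by simp
  have 2: "(Snd \<C> A B \<boxtimes> Id \<C> D) \<cdot> Tuple \<C> (Tuple \<C> a b) d = Tuple \<C> b d"
    using Times_Tuple[OF Snd_Hom[OF o(1,2)] Id_Hom[OF o(3)] ab assms(3)]
      Snd_Tuple[OF assms(1,2)] Id_left[OF assms(3)] by simp
  show ?thesis unfolding Assoc_def
    using Tuple_Comp[OF Comp_Hom[OF F Fst_Hom[OF o(1,2)]] S t] 1 2 by simp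
qed

text \<open>Equality of arrows out of a product may be checked on generalized elements.\<close>

lemma Prod_ext:
  assumes "f \<in> Hom \<C> (A \<^bold>\<times> B) Y" "g \<in> Hom \<C> (A \<^bold>\<times> B) Y" "A \<in> Obj \<C>" "B \<in> Obj \<C>"
    and eq: "\<And>X a b. a \<in> Hom \<C> X A \<Longrightarrow> b \<in> Hom \<C> X B \<Longrightarrow> f \<cdot> Tuple \<C> a b = g \<cdot> Tuple \<C> a b"
  shows "f = g"
proof -
  have o: "A \<^bold>\<times> B \<in> Obj \<C>" using assms HomD by blast
  have "Tuple \<C> (Fst \<C> A B) (Snd \<C> A B) = Id \<C> (A \<^bold>\<times> B)"
    using Tuple_eta[OF Id_Hom[OF o] assms(3,4)]
      Id_right[OF Fst_Hom[OF assms(3,4)]] Id_right[OF Snd_Hom[OF assms(3,4)]] by simp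
  then show ?thesis
    using eq[OF Fst_Hom[OF assms(3,4)] Snd_Hom[OF assms(3,4)]] Id_right assms(1,2) by metis
qed

lemma Tuple_expand:
  assumes "h \<in> Hom \<C> X (A \<^bold>\<times> B)" "A \<in> Obj \<C>" "B \<in> Obj \<C>"
  obtains a b where "a \<in> Hom \<C> X A" "b \<in> Hom \<C> X B" "h = Tuple \<C> a b"
  using Tuple_eta[OF assms] Comp_Hom[OF assms(1) Fst_Hom[OF assms(2,3)]]
    Comp_Hom[OF assms(1) Snd_Hom[OF assms(2,3)]] by metis

end

context monoid_object
begin

lemma mul_el:
  "x \<in> Hom \<C> X (Carr M) \<Longrightarrow> y \<in> Hom \<C> X (Carr M) \<Longrightarrow> Mul M \<cdot> Tuple \<C> x y \<in> Hom \<C> X (Carr M)"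
  using Comp_Hom Tuple_Hom Mul_Hom by blast

lemma unt_el: "X \<in> Obj \<C> \<Longrightarrow> Unt M \<cdot> Bang \<C> X \<in> Hom \<C> X (Carr M)"
  using Comp_Hom Bang_Hom Unt_Hom by blast

lemma unt_Comp:
  assumes "h \<in> Hom \<C> Y X"
  shows "(Unt M \<cdot> Bang \<C> X) \<cdot> h = Unt M \<cdot> Bang \<C> Y"
proof -
  have "X \<in> Obj \<C>" using HomD assms by blast
  then show ?thesis
    using Comp_assoc[OF assms Bang_Hom Unt_Hom] Bang_eq[OF Comp_Hom[OF assms Bang_Hom]] by simp
qed

lemma mul_Comp:
  assumes "x \<in> Hom \<C> X (Carr M)" "y \<in> Hom \<C> X (Carr M)" "h \<in> Hom \<C> Y X"
  shows "(Mul M \<cdot> Tuple \<C> x y) \<cdot> h = Mul M \<cdot> Tuple \<C> (x \<cdot> h) (y \<cdot> h)"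
  using Comp_assoc[OF assms(3) Tuple_Hom[OF assms(1,2)] Mul_Hom] Tuple_Comp[OF assms] by simp

lemma is_act_iff:
  "is_act \<C> M (A, \<alpha>) \<longleftrightarrow> A \<in> Obj \<C> \<and> \<alpha> \<in> Hom \<C> (A \<^bold>\<times> Carr M) A \<and>
    (\<forall>X. \<forall>a \<in> Hom \<C> X A. \<alpha> \<cdot> Tuple \<C> a (Unt M \<cdot> Bang \<C> X) = a) \<and>
    (\<forall>X. \<forall>a \<in> Hom \<C> X A. \<forall>x \<in> Hom \<C> X (Carr M). \<forall>y \<in> Hom \<C> X (Carr M).
      \<alpha> \<cdot> Tuple \<C> (\<alpha> \<cdot> Tuple \<C> a x) y = \<alpha> \<cdot> Tuple \<C> a (Mul M \<cdot> Tuple \<C> x y))"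
  (is "_ \<longleftrightarrow> _ \<and> _ \<and> ?unit \<and> ?assoc")
proof (cases "A \<in> Obj \<C> \<and> \<alpha> \<in> Hom \<C> (A \<^bold>\<times> Carr M) A")
  case True
  then have A: "A \<in> Obj \<C>" and \<alpha>: "\<alpha> \<in> Hom \<C> (A \<^bold>\<times> Carr M) A" by auto
  note M = Carr_Obj
  note AM = Prod_Obj[OF A M]
  have u: "(\<alpha> \<cdot> (Id \<C> A \<boxtimes> Unt M)) \<cdot> Tuple \<C> a t = \<alpha> \<cdot> Tuple \<C> a (Unt M \<cdot> Bang \<C> X)"
    if a: "a \<in> Hom \<C> X A" and t: "t \<in> Hom \<C> X (One \<C>)" for X a t
    using Comp_assoc[OF Tuple_Hom[OF a t] Times_Hom[OF Id_Hom[OF A] Unt_Hom] \<alpha>]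
      Times_Tuple[OF Id_Hom[OF A] Unt_Hom a t] Id_left[OF a] Bang_eq[OF t] by simp
  have "\<alpha> \<cdot> (Id \<C> A \<boxtimes> Unt M) = Fst \<C> A (One \<C>) \<longleftrightarrow> ?unit"
  proof
    assume eq: "\<alpha> \<cdot> (Id \<C> A \<boxtimes> Unt M) = Fst \<C> A (One \<C>)"
    show ?unit
    proof (intro allI ballI)
      fix X a assume a: "a \<in> Hom \<C> X A"
      then have t: "Bang \<C> X \<in> Hom \<C> X (One \<C>)" using HomD Bang_Hom by blast
      show "\<alpha> \<cdot> Tuple \<C> a (Unt M \<cdot> Bang \<C> X) = a"
        using u[OF a t] eq Fst_Tuple[OF a t] by simp
    qed
  next
    assume unit: ?unit
    show "\<alpha> \<cdot> (Id \<C> A \<boxtimes> Unt M) = Fst \<C> A (One \<C>)"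
      by (rule Prod_ext[OF Comp_Hom[OF Times_Hom[OF Id_Hom[OF A] Unt_Hom] \<alpha>]
            Fst_Hom[OF A One_Obj] A One_Obj])
        (use u unit Fst_Tuple in auto)
  qed
  moreover
  have aM: "\<alpha> \<boxtimes> Id \<C> (Carr M) \<in> Hom \<C> ((A \<^bold>\<times> Carr M) \<^bold>\<times> Carr M) (A \<^bold>\<times> Carr M)"
    using Times_Hom[OF \<alpha> Id_Hom[OF M]] .
  have As: "Assoc \<C> A (Carr M) (Carr M)
      \<in> Hom \<C> ((A \<^bold>\<times> Carr M) \<^bold>\<times> Carr M) (A \<^bold>\<times> (Carr M \<^bold>\<times> Carr M))"
    using Assoc_Hom A M by blast
  have m: "Id \<C> A \<boxtimes> Mul M \<in> Hom \<C> (A \<^bold>\<times> (Carr M \<^bold>\<times> Carr M)) (A \<^bold>\<times> Carr M)"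
    using Times_Hom[OF Id_Hom[OF A] Mul_Hom] .
  have l: "(\<alpha> \<cdot> (\<alpha> \<boxtimes> Id \<C> (Carr M))) \<cdot> Tuple \<C> (Tuple \<C> a x) y
      = \<alpha> \<cdot> Tuple \<C> (\<alpha> \<cdot> Tuple \<C> a x) y" (is ?l)
    and r: "(\<alpha> \<cdot> (Id \<C> A \<boxtimes> Mul M) \<cdot> Assoc \<C> A (Carr M) (Carr M)) \<cdot> Tuple \<C> (Tuple \<C> a x) y
      = \<alpha> \<cdot> Tuple \<C> a (Mul M \<cdot> Tuple \<C> x y)" (is ?r)
    if a: "a \<in> Hom \<C> X A" and x: "x \<in> Hom \<C> X (Carr M)" and y: "y \<in> Hom \<C> X (Carr M)"
    for X a x y
  proof -
    note ax = Tuple_Hom[OF a x] note axy = Tuple_Hom[OF ax y]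
    show ?l
      using Comp_assoc[OF axy aM \<alpha>] Times_Tuple[OF \<alpha> Id_Hom[OF M] ax y] Id_left[OF y] by simp
    show ?r
      using Comp_assoc[OF axy Comp_Hom[OF As m] \<alpha>] Comp_assoc[OF axy As m] Assoc_Tuple[OF a x y]
        Times_Tuple[OF Id_Hom[OF A] Mul_Hom a Tuple_Hom[OF x y]] Id_left[OF a] by simp
  qed
  have "\<alpha> \<cdot> (\<alpha> \<boxtimes> Id \<C> (Carr M)) = \<alpha> \<cdot> (Id \<C> A \<boxtimes> Mul M) \<cdot> Assoc \<C> A (Carr M) (Carr M)
      \<longleftrightarrow> ?assoc"
  proof
    assume "\<alpha> \<cdot> (\<alpha> \<boxtimes> Id \<C> (Carr M)) = \<alpha> \<cdot> (Id \<C> A \<boxtimes> Mul M) \<cdot> Assoc \<C> A (Carr M) (Carr M)"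
    then show ?assoc using l r by metis
  next
    assume assoc: ?assoc
    show "\<alpha> \<cdot> (\<alpha> \<boxtimes> Id \<C> (Carr M)) = \<alpha> \<cdot> (Id \<C> A \<boxtimes> Mul M) \<cdot> Assoc \<C> A (Carr M) (Carr M)"
    proof (rule Prod_ext[OF Comp_Hom[OF aM \<alpha>] Comp_Hom[OF Comp_Hom[OF As m] \<alpha>] AM M])
      fix X p y assume p: "p \<in> Hom \<C> X (A \<^bold>\<times> Carr M)" and y: "y \<in> Hom \<C> X (Carr M)"
      obtain a x where "a \<in> Hom \<C> X A" "x \<in> Hom \<C> X (Carr M)" "p = Tuple \<C> a x"
        using Tuple_expand[OF p A M] .
      then show "(\<alpha> \<cdot> (\<alpha> \<boxtimes> Id \<C> (Carr M))) \<cdot> Tuple \<C> p y =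
          (\<alpha> \<cdot> (Id \<C> A \<boxtimes> Mul M) \<cdot> Assoc \<C> A (Carr M) (Carr M)) \<cdot> Tuple \<C> p y"
        using l r assoc y by simp
    qed
  qed
  ultimately show ?thesis using True by (simp add: is_act_def)
qed (auto simp: is_act_def)

lemma is_act_morphism_iff:
  assumes act: "is_act \<C> M (A, \<alpha>)" "is_act \<C> M (B, \<beta>)"
  shows "is_act_morphism \<C> M (A, \<alpha>) (B, \<beta>) h \<longleftrightarrow> h \<in> Hom \<C> A B \<and>
    (\<forall>X. \<forall>a \<in> Hom \<C> X A. \<forall>x \<in> Hom \<C> X (Carr M).
      h \<cdot> (\<alpha> \<cdot> Tuple \<C> a x) = \<beta> \<cdot> Tuple \<C> (h \<cdot> a) x)"
proof (cases "h \<in> Hom \<C> A B")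
  case h: True
  note M = Carr_Obj
  have A: "A \<in> Obj \<C>" and \<alpha>: "\<alpha> \<in> Hom \<C> (A \<^bold>\<times> Carr M) A" and \<beta>: "\<beta> \<in> Hom \<C> (B \<^bold>\<times> Carr M) B"
    using act by (auto simp: is_act_def)
  note hM = Times_Hom[OF h Id_Hom[OF M]]
  have *: "(h \<cdot> \<alpha>) \<cdot> Tuple \<C> a x = h \<cdot> (\<alpha> \<cdot> Tuple \<C> a x)"
      "(\<beta> \<cdot> (h \<boxtimes> Id \<C> (Carr M))) \<cdot> Tuple \<C> a x = \<beta> \<cdot> Tuple \<C> (h \<cdot> a) x"
    if a: "a \<in> Hom \<C> X A" and x: "x \<in> Hom \<C> X (Carr M)" for X a x
    using Comp_assoc[OF Tuple_Hom[OF a x] \<alpha> h] Comp_assoc[OF Tuple_Hom[OF a x] hM \<beta>]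
      Times_Tuple[OF h Id_Hom[OF M] a x] Id_left[OF x] by simp_all
  have "h \<cdot> \<alpha> = \<beta> \<cdot> (h \<boxtimes> Id \<C> (Carr M)) \<longleftrightarrow> (\<forall>X. \<forall>a \<in> Hom \<C> X A. \<forall>x \<in> Hom \<C> X (Carr M).
      h \<cdot> (\<alpha> \<cdot> Tuple \<C> a x) = \<beta> \<cdot> Tuple \<C> (h \<cdot> a) x)" (is "?eq \<longleftrightarrow> ?el")
  proof
    assume ?eq then show ?el using * by metis
  next
    assume el: ?el
    show ?eq
      by (rule Prod_ext[OF Comp_Hom[OF \<alpha> h] Comp_Hom[OF hM \<beta>] A M]) (use * el in auto)
  qed
  then show ?thesis using h by (simp add: is_act_morphism_def)
qed (simp add: is_act_morphism_def)

lemma Hom_Acts: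
  "k \<in> Hom (Acts \<C> M) X Y \<longleftrightarrow> (\<exists>h. k = (X, h, Y) \<and> is_act \<C> M X \<and> is_act \<C> M Y \<and>
    is_act_morphism \<C> M X Y h)"
  by (auto simp: Hom_def Acts_def)

lemma Free_act_Tuple:
  assumes "c \<in> Hom \<C> X C" "x \<in> Hom \<C> X (Carr M)" "y \<in> Hom \<C> X (Carr M)"
  shows "snd (Free_act \<C> M C) \<cdot> Tuple \<C> (Tuple \<C> c x) y = Tuple \<C> c (Mul M \<cdot> Tuple \<C> x y)"
proof -
  have C: "C \<in> Obj \<C>" using assms HomD by blast
  note t = Tuple_Hom[OF Tuple_Hom[OF assms(1,2)] assms(3)]
  show ?thesis
    using Comp_assoc[OF t Assoc_Hom[OF C Carr_Obj Carr_Obj] Times_Hom[OF Id_Hom[OF C] Mul_Hom]]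
      Assoc_Tuple[OF assms] Times_Tuple[OF Id_Hom[OF C] Mul_Hom assms(1) Tuple_Hom[OF assms(2,3)]]
      Id_left[OF assms(1)]
    by (simp add: Free_act_def)
qed

lemma mul_assoc_el:
  assumes "x \<in> Hom \<C> X (Carr M)" "y \<in> Hom \<C> X (Carr M)" "z \<in> Hom \<C> X (Carr M)"
  shows "Mul M \<cdot> Tuple \<C> (Mul M \<cdot> Tuple \<C> x y) z = Mul M \<cdot> Tuple \<C> x (Mul M \<cdot> Tuple \<C> y z)"
    and "Mul M \<cdot> Tuple \<C> x (Unt M \<cdot> Bang \<C> X) = x"
  using is_act_iff[of "Carr M" "Mul M"] assms Carr_Obj Mul_Hom Mul_assoc Unt_right
  by (simp_all add: is_act_def)

lemma unt_left_el:
  assumes x: "x \<in> Hom \<C> X (Carr M)"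
  shows "Mul M \<cdot> Tuple \<C> (Unt M \<cdot> Bang \<C> X) x = x"
proof -
  have t: "Bang \<C> X \<in> Hom \<C> X (One \<C>)" using HomD[OF x] Bang_Hom by blast
  show ?thesis
    using Comp_assoc[OF Tuple_Hom[OF t x] Times_Hom[OF Unt_Hom Id_Hom[OF Carr_Obj]] Mul_Hom]
      Times_Tuple[OF Unt_Hom Id_Hom[OF Carr_Obj] t x] Id_left[OF x] Snd_Tuple[OF t x] Unt_left
    by simp
qed

lemma Free_act_is_act:
  assumes C: "C \<in> Obj \<C>"
  shows "is_act \<C> M (Free_act \<C> M C)"
proof -
  note M = Carr_Obj
  obtain \<alpha> where F: "Free_act \<C> M C = (C \<^bold>\<times> Carr M, \<alpha>)"
    and \<alpha>: "\<alpha> \<in> Hom \<C> ((C \<^bold>\<times> Carr M) \<^bold>\<times> Carr M) (C \<^bold>\<times> Carr M)"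
    using Comp_Hom[OF Assoc_Hom[OF C M M] Times_Hom[OF Id_Hom[OF C] Mul_Hom]]
    by (simp add: Free_act_def)
  have t: "\<alpha> \<cdot> Tuple \<C> (Tuple \<C> c x) y = Tuple \<C> c (Mul M \<cdot> Tuple \<C> x y)"
    if "c \<in> Hom \<C> X C" "x \<in> Hom \<C> X (Carr M)" "y \<in> Hom \<C> X (Carr M)" for X c x y
    using Free_act_Tuple[OF that] F by simp
  show ?thesis unfolding F is_act_iff
  proof (intro conjI allI ballI Prod_Obj[OF C M] \<alpha>)
    fix X p assume p: "p \<in> Hom \<C> X (C \<^bold>\<times> Carr M)"
    then have X: "X \<in> Obj \<C>" using HomD by blast
    obtain c x where c: "c \<in> Hom \<C> X C" and x: "x \<in> Hom \<C> X (Carr M)" and p': "p = Tuple \<C> c x"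
      using Tuple_expand[OF p C M] .
    show "\<alpha> \<cdot> Tuple \<C> p (Unt M \<cdot> Bang \<C> X) = p"
      using t[OF c x unt_el[OF X]] mul_assoc_el(2)[OF x x x] p' by simp
    fix y z assume y: "y \<in> Hom \<C> X (Carr M)" and z: "z \<in> Hom \<C> X (Carr M)"
    show "\<alpha> \<cdot> Tuple \<C> (\<alpha> \<cdot> Tuple \<C> p y) z = \<alpha> \<cdot> Tuple \<C> p (Mul M \<cdot> Tuple \<C> y z)"
      using t[OF c x y] t[OF c mul_el[OF x y] z] t[OF c x mul_el[OF y z]] mul_assoc_el(1)[OF x y z] p'
      by simp
  qed
qed

lemma category_Acts: "category (Acts \<C> M)"
proof (rule category.intro)
  fix f assume "f \<in> Arr (Acts \<C> M)"
  then show "Dom (Acts \<C> M) f \<in> Obj (Acts \<C> M)" "Cod (Acts \<C> M) f \<in> Obj (Acts \<C> M)"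
    by (auto simp: Acts_def)
next
  fix X assume "X \<in> Obj (Acts \<C> M)"
  then have act: "is_act \<C> M X" by (simp add: Acts_def)
  obtain A \<alpha> where X: "X = (A, \<alpha>)" by (cases X)
  have A: "A \<in> Obj \<C>" and \<alpha>: "\<alpha> \<in> Hom \<C> (A \<^bold>\<times> Carr M) A" using act X by (auto simp: is_act_def)
  have "is_act_morphism \<C> M (A, \<alpha>) (A, \<alpha>) (Id \<C> A)"
    unfolding is_act_morphism_iff[OF act[unfolded X] act[unfolded X]]
  proof (intro conjI allI ballI Id_Hom[OF A])
    fix V a x assume a: "a \<in> Hom \<C> V A" and x: "x \<in> Hom \<C> V (Carr M)"
    show "Id \<C> A \<cdot> (\<alpha> \<cdot> Tuple \<C> a x) = \<alpha> \<cdot> Tuple \<C> (Id \<C> A \<cdot> a) x"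
      using Id_left[OF a] Id_left[OF Comp_Hom[OF Tuple_Hom[OF a x] \<alpha>]] by simp
  qed
  then show "Id (Acts \<C> M) X \<in> Hom (Acts \<C> M) X X"
    using act X by (simp add: Hom_Acts) (simp add: Acts_def)
next
  fix f X Y g Z assume "f \<in> Hom (Acts \<C> M) X Y" "g \<in> Hom (Acts \<C> M) Y Z"
  then obtain h k where f: "f = (X, h, Y)" and g: "g = (Y, k, Z)"
    and act: "is_act \<C> M X" "is_act \<C> M Y" "is_act \<C> M Z"
    and mor: "is_act_morphism \<C> M X Y h" "is_act_morphism \<C> M Y Z k"
    by (auto simp: Hom_Acts)
  obtain A \<alpha> B \<beta> D \<delta> where X: "X = (A, \<alpha>)" and Y: "Y = (B, \<beta>)" and Z: "Z = (D, \<delta>)"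
    by (cases X, cases Y, cases Z)
  have \<alpha>: "\<alpha> \<in> Hom \<C> (A \<^bold>\<times> Carr M) A" using act X by (simp add: is_act_def)
  have h: "h \<in> Hom \<C> A B" and k: "k \<in> Hom \<C> B D" using mor X Y Z by (auto simp: is_act_morphism_def)
  have "is_act_morphism \<C> M X Z (k \<cdot> h)"
    unfolding X Z is_act_morphism_iff[OF act(1)[unfolded X] act(3)[unfolded Z]]
  proof (intro conjI allI ballI Comp_Hom[OF h k])
    fix V a x assume a: "a \<in> Hom \<C> V A" and x: "x \<in> Hom \<C> V (Carr M)"
    have "h \<cdot> (\<alpha> \<cdot> Tuple \<C> a x) = \<beta> \<cdot> Tuple \<C> (h \<cdot> a) x"
      using mor(1) a x is_act_morphism_iff[OF act(1)[unfolded X] act(2)[unfolded Y]] X Y by blast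
    moreover have "k \<cdot> (\<beta> \<cdot> Tuple \<C> (h \<cdot> a) x) = \<delta> \<cdot> Tuple \<C> (k \<cdot> (h \<cdot> a)) x"
      using mor(2) Comp_Hom[OF a h] x is_act_morphism_iff[OF act(2)[unfolded Y] act(3)[unfolded Z]]
        Y Z by blast
    ultimately show "(k \<cdot> h) \<cdot> (\<alpha> \<cdot> Tuple \<C> a x) = \<delta> \<cdot> Tuple \<C> ((k \<cdot> h) \<cdot> a) x"
      using Comp_assoc[OF Comp_Hom[OF Tuple_Hom[OF a x] \<alpha>] h k] Comp_assoc[OF a h k] by simp
  qed
  then show "g \<cdot>\<^bsub>Acts \<C> M\<^esub> f \<in> Hom (Acts \<C> M) X Z"
    using act f g by (simp add: Hom_Acts) (simp add: Acts_def)
next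
  fix f X Y assume "f \<in> Hom (Acts \<C> M) X Y"
  then obtain h where f: "f = (X, h, Y)" and h: "h \<in> Hom \<C> (fst X) (fst Y)"
    by (auto simp: Hom_Acts is_act_morphism_def case_prod_beta)
  show "Id (Acts \<C> M) Y \<cdot>\<^bsub>Acts \<C> M\<^esub> f = f" "f \<cdot>\<^bsub>Acts \<C> M\<^esub> Id (Acts \<C> M) X = f"
    using Id_left[OF h] Id_right[OF h] by (simp_all add: f Acts_def)
next
  fix f X Y g Z h W
  assume "f \<in> Hom (Acts \<C> M) X Y" "g \<in> Hom (Acts \<C> M) Y Z" "h \<in> Hom (Acts \<C> M) Z W"
  then obtain f' g' h' where "f = (X, f', Y)" "g = (Y, g', Z)" "h = (Z, h', W)"
    and "f' \<in> Hom \<C> (fst X) (fst Y)" "g' \<in> Hom \<C> (fst Y) (fst Z)" "h' \<in> Hom \<C> (fst Z) (fst W)"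
    by (auto simp: Hom_Acts is_act_morphism_def case_prod_beta)
  then show "(h \<cdot>\<^bsub>Acts \<C> M\<^esub> g) \<cdot>\<^bsub>Acts \<C> M\<^esub> f = h \<cdot>\<^bsub>Acts \<C> M\<^esub> (g \<cdot>\<^bsub>Acts \<C> M\<^esub> f)"
    using Comp_assoc[of f' _ _ g' _ h'] by (simp add: Acts_def)
qed

lemma Free_unit_eq:
  assumes C: "C \<in> Obj \<C>"
  shows "Free_unit \<C> M C = Tuple \<C> (Id \<C> C) (Unt M \<cdot> Bang \<C> C)"
  using Times_Tuple[OF Id_Hom[OF C] Unt_Hom Id_Hom[OF C] Bang_Hom[OF C]] Id_left[OF Id_Hom[OF C]]
  by (simp add: Free_unit_def)

text \<open>The universal property of the unit, i.e. left adjointness of \<^const>\<open>Free_act\<close>.\<close>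

lemma extension_unique:
  assumes C: "C \<in> Obj \<C>" and act: "is_act \<C> M (B, \<beta>)" and g: "g \<in> Hom \<C> C B"
  shows "k \<in> Hom (Acts \<C> M) (Free_act \<C> M C) (B, \<beta>) \<and> underlying k \<cdot> Free_unit \<C> M C = g \<longleftrightarrow>
    k = (Free_act \<C> M C, \<beta> \<cdot> (g \<boxtimes> Id \<C> (Carr M)), (B, \<beta>))"
proof -
  note M = Carr_Obj and uC = unt_el[OF C]
  define \<gamma> where "\<gamma> = snd (Free_act \<C> M C)"
  have F: "Free_act \<C> M C = (C \<^bold>\<times> Carr M, \<gamma>)" by (simp add: \<gamma>_def Free_act_def)
  have actF: "is_act \<C> M (C \<^bold>\<times> Carr M, \<gamma>)" using Free_act_is_act[OF C] F by simp
  have \<gamma>: "\<gamma> \<cdot> Tuple \<C> (Tuple \<C> c x) y = Tuple \<C> c (Mul M \<cdot> Tuple \<C> x y)"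
    if "c \<in> Hom \<C> X C" "x \<in> Hom \<C> X (Carr M)" "y \<in> Hom \<C> X (Carr M)" for X c x y
    using Free_act_Tuple[OF that] \<gamma>_def by simp
  have \<beta>: "\<beta> \<in> Hom \<C> (B \<^bold>\<times> Carr M) B"
    and \<beta>u: "\<And>X b. b \<in> Hom \<C> X B \<Longrightarrow> \<beta> \<cdot> Tuple \<C> b (Unt M \<cdot> Bang \<C> X) = b"
    and \<beta>m: "\<And>X b x y. b \<in> Hom \<C> X B \<Longrightarrow> x \<in> Hom \<C> X (Carr M) \<Longrightarrow> y \<in> Hom \<C> X (Carr M) \<Longrightarrow>
      \<beta> \<cdot> Tuple \<C> (\<beta> \<cdot> Tuple \<C> b x) y = \<beta> \<cdot> Tuple \<C> b (Mul M \<cdot> Tuple \<C> x y)"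
    using act unfolding is_act_iff by blast+
  define e where "e = \<beta> \<cdot> (g \<boxtimes> Id \<C> (Carr M))"
  note gM = Times_Hom[OF g Id_Hom[OF M]]
  have e: "e \<in> Hom \<C> (C \<^bold>\<times> Carr M) B" unfolding e_def using Comp_Hom[OF gM \<beta>] .
  have e_el: "e \<cdot> Tuple \<C> c x = \<beta> \<cdot> Tuple \<C> (g \<cdot> c) x"
    if c: "c \<in> Hom \<C> X C" and x: "x \<in> Hom \<C> X (Carr M)" for X c x
    unfolding e_def
    using Comp_assoc[OF Tuple_Hom[OF c x] gM \<beta>] Times_Tuple[OF g Id_Hom[OF M] c x] Id_left[OF x]
    by simp
  have unit: "Free_unit \<C> M C = Tuple \<C> (Id \<C> C) (Unt M \<cdot> Bang \<C> C)" using Free_unit_eq[OF C] .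
  have unit_Hom: "Free_unit \<C> M C \<in> Hom \<C> C (C \<^bold>\<times> Carr M)"
    unfolding unit using Tuple_Hom[OF Id_Hom[OF C] uC] .
  have "is_act_morphism \<C> M (C \<^bold>\<times> Carr M, \<gamma>) (B, \<beta>) e"
    unfolding is_act_morphism_iff[OF actF act]
  proof (intro conjI allI ballI e)
    fix X p y assume p: "p \<in> Hom \<C> X (C \<^bold>\<times> Carr M)" and y: "y \<in> Hom \<C> X (Carr M)"
    obtain c x where c: "c \<in> Hom \<C> X C" and x: "x \<in> Hom \<C> X (Carr M)" and p': "p = Tuple \<C> c x"
      using Tuple_expand[OF p C M] .
    show "e \<cdot> (\<gamma> \<cdot> Tuple \<C> p y) = \<beta> \<cdot> Tuple \<C> (e \<cdot> p) y"
      using \<gamma>[OF c x y] e_el[OF c x] e_el[OF c mul_el[OF x y]] \<beta>m[OF Comp_Hom[OF c g] x y] p' by simp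
  qed
  moreover have "e \<cdot> Free_unit \<C> M C = g"
    using e_el[OF Id_Hom[OF C] uC] Id_right[OF g] \<beta>u[OF g] unit by simp
  moreover have "h = e" if mor: "is_act_morphism \<C> M (C \<^bold>\<times> Carr M, \<gamma>) (B, \<beta>) h"
    and ext: "h \<cdot> Free_unit \<C> M C = g" for h
  proof -
    have h: "h \<in> Hom \<C> (C \<^bold>\<times> Carr M) B" using mor by (simp add: is_act_morphism_def)
    show ?thesis
    proof (rule Prod_ext[OF h e C M])
      fix X c x assume c: "c \<in> Hom \<C> X C" and x: "x \<in> Hom \<C> X (Carr M)"
      then have X: "X \<in> Obj \<C>" using HomD by blast
      have "Free_unit \<C> M C \<cdot> c = Tuple \<C> c (Unt M \<cdot> Bang \<C> X)"
        unfolding unit using Tuple_Comp[OF Id_Hom[OF C] uC c] Id_left[OF c] unt_Comp[OF c] by simp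
      then have hc: "h \<cdot> Tuple \<C> c (Unt M \<cdot> Bang \<C> X) = g \<cdot> c"
        using Comp_assoc[OF c unit_Hom h] ext by simp
      have "h \<cdot> Tuple \<C> c x = h \<cdot> (\<gamma> \<cdot> Tuple \<C> (Tuple \<C> c (Unt M \<cdot> Bang \<C> X)) x)"
        using \<gamma>[OF c unt_el[OF X] x] unt_left_el[OF x] by simp
      also have "\<dots> = \<beta> \<cdot> Tuple \<C> (g \<cdot> c) x"
        using mor Tuple_Hom[OF c unt_el[OF X]] x hc by (simp add: is_act_morphism_iff[OF actF act])
      finally show "h \<cdot> Tuple \<C> c x = e \<cdot> Tuple \<C> c x" using e_el[OF c x] by simp
    qed
  qed
  ultimately show ?thesis using actF act unfolding F Hom_Acts e_def[symmetric] by fastforce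
qed

lemma Sharp_unique_existence:
  assumes "C \<in> Obj \<C>" "Y \<in> Obj \<C>" "g \<in> Hom \<C> C (Y \<^bold>\<times> Carr M)"
  shows "\<exists>!k. k \<in> Hom (Acts \<C> M) (Free_act \<C> M C) (Free_act \<C> M Y) \<and>
    underlying k \<cdot> Free_unit \<C> M C = g"
  using extension_unique[OF assms(1) Free_act_is_act[OF assms(2), unfolded Free_act_def] assms(3)]
  unfolding Free_act_def by simp

lemma Sharp_eq:
  assumes "C \<in> Obj \<C>" "Y \<in> Obj \<C>" "g \<in> Hom \<C> C (Y \<^bold>\<times> Carr M)"
  shows "Sharp \<C> M C Y g = (Free_act \<C> M C,
    ((Id \<C> Y \<boxtimes> Mul M) \<cdot> Assoc \<C> Y (Carr M) (Carr M)) \<cdot> (g \<boxtimes> Id \<C> (Carr M)), Free_act \<C> M Y)"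
  using extension_unique[OF assms(1) Free_act_is_act[OF assms(2), unfolded Free_act_def] assms(3)]
  unfolding Sharp_def Free_act_def by simp

end

end

theory Submission
  imports Defs
begin

text \<open>
  On generalized elements \<open>(c, x)\<close> of \<open>C \<times> M\<close> the endomorphism \<open>E_map \<C> M C f\<close> sends
  \<open>(c, x)\<close> to \<open>(c, f(c) x)\<close> (lemma \<open>underlying_E_map_Tuple\<close>): it multiplies the second component
  from the left, which commutes with the right action of \<open>M\<close>. All four claims follow from this
  description together with freeness of \<open>F\<^sub>M C\<close>, by which an act endomorphism \<open>k\<close> is determined
  by its composite with the unit \<open>C \<rightarrow> C \<times> M\<close> (lemma \<open>E_map_eq_iff\<close>).

  Composing with the unit, the identity of \<open>F\<^sub>M C\<close> gives \<open>\<langle>id, e\<^sub>C\<rangle>\<close>, and the composite of the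
  endomorphisms of \<open>\<phi>\<close> and \<open>\<psi>\<close> gives \<open>\<langle>id, \<phi> \<ast> \<psi>\<rangle>\<close>, since \<open>(c, \<psi>(c))\<close> is sent to
  \<open>(c, \<phi>(c) \<psi>(c))\<close>; these are the values on the unit of the endomorphisms of \<open>e\<^sub>C\<close> and
  \<open>\<phi> \<ast> \<psi>\<close>, so \<open>E_map\<close> is a monoid morphism. Restricting along the unit and projecting to \<open>M\<close>
  recovers \<open>f\<close> from \<open>\<langle>id, f\<rangle>\<close>, which gives the left inverse. If \<open>M\<close> is a group object with
  inversion \<open>i\<close>, then the composite of \<open>f\<close> and \<open>i\<close> is a convolution inverse of \<open>f\<close>, and a
  monoid morphism sends invertible elements to invertible ones, that is, to automorphisms.
\<close>

lemma (in category) monoid_End_monoid: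
  assumes A: "A \<in> Obj \<C>"
  shows "monoid (End_monoid \<C> A)"
  by (rule monoidI) (auto simp: End_monoid_def Id_Hom[OF A]
      intro: Comp_Hom Comp_assoc Id_left Id_right)

text \<open>Invertibility passes along a morphism of monoids; in an endomorphism monoid the invertible
  elements are the automorphisms.\<close>

lemma automorphism_if_monoid_morphism:
  assumes h: "monoid_morphism A (End_monoid \<D> X) h"
    and f: "f \<in> carrier A" and g: "g \<in> carrier A"
    and inv: "g \<otimes>\<^bsub>A\<^esub> f = \<one>\<^bsub>A\<^esub>" "f \<otimes>\<^bsub>A\<^esub> g = \<one>\<^bsub>A\<^esub>"
  shows "automorphism \<D> X (h f)"
proof -
  have hom: "h \<in> hom A (End_monoid \<D> X)" and one: "h \<one>\<^bsub>A\<^esub> = Id \<D> X"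
    using h by (simp_all add: monoid_morphism_def End_monoid_def)
  have "h f \<in> Hom \<D> X X" "h g \<in> Hom \<D> X X"
    using hom_in_carrier[OF hom] f g by (simp_all add: End_monoid_def)
  moreover have "h g \<cdot>\<^bsub>\<D>\<^esub> h f = Id \<D> X" "h f \<cdot>\<^bsub>\<D>\<^esub> h g = Id \<D> X"
    using hom_mult[OF hom g f] hom_mult[OF hom f g] inv one by (simp_all add: End_monoid_def)
  ultimately show ?thesis by (auto simp: isomorphism_def)
qed

context monoid_object
begin

text \<open>This form of the convolution product reduces computations with it to computations with
  generalized elements of \<open>M\<close>.\<close>

lemma Conv_mult_eq:
  assumes \<phi>: "\<phi> \<in> Hom \<C> C (Carr M)" and \<psi>: "\<psi> \<in> Hom \<C> C (Carr M)"
  shows "\<phi> \<otimes>\<^bsub>Conv_monoid \<C> M C\<^esub> \<psi> = Mul M \<cdot> Tuple \<C> \<phi> \<psi>"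
proof -
  have C: "C \<in> Obj \<C>" using HomD[OF \<phi>] by simp
  show ?thesis
    using Times_Tuple[OF \<phi> \<psi> Id_Hom[OF C] Id_Hom[OF C]] Id_right[OF \<phi>] Id_right[OF \<psi>]
    by (simp add: Conv_monoid_def Diag_def)
qed

lemma monoid_Conv_monoid:
  assumes C: "C \<in> Obj \<C>"
  shows "monoid (Conv_monoid \<C> M C)" (is "monoid ?A")
proof (rule monoidI)
  have carr: "carrier ?A = Hom \<C> C (Carr M)" and one: "\<one>\<^bsub>?A\<^esub> = Unt M \<cdot> Bang \<C> C"
    by (simp_all add: Conv_monoid_def)
  have one_el: "\<one>\<^bsub>?A\<^esub> \<in> Hom \<C> C (Carr M)" using unt_el[OF C] one by simp
  then show "\<one>\<^bsub>?A\<^esub> \<in> carrier ?A" using carr by simp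
  fix x assume "x \<in> carrier ?A"
  then have x: "x \<in> Hom \<C> C (Carr M)" using carr by simp
  show "\<one>\<^bsub>?A\<^esub> \<otimes>\<^bsub>?A\<^esub> x = x" "x \<otimes>\<^bsub>?A\<^esub> \<one>\<^bsub>?A\<^esub> = x"
    using Conv_mult_eq[OF one_el x] Conv_mult_eq[OF x one_el] unt_left_el[OF x]
      mul_assoc_el(2)[OF x x x] one by simp_all
  fix y assume "y \<in> carrier ?A"
  then have y: "y \<in> Hom \<C> C (Carr M)" using carr by simp
  show "x \<otimes>\<^bsub>?A\<^esub> y \<in> carrier ?A" using Conv_mult_eq[OF x y] mul_el[OF x y] carr by simp
  fix z assume "z \<in> carrier ?A"
  then have z: "z \<in> Hom \<C> C (Carr M)" using carr by simp
  show "x \<otimes>\<^bsub>?A\<^esub> y \<otimes>\<^bsub>?A\<^esub> z = x \<otimes>\<^bsub>?A\<^esub> (y \<otimes>\<^bsub>?A\<^esub> z)"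
    using mul_assoc_el(1)[OF x y z] Conv_mult_eq[OF x y] Conv_mult_eq[OF y z]
      Conv_mult_eq[OF mul_el[OF x y] z] Conv_mult_eq[OF x mul_el[OF y z]] by simp
qed

text \<open>The universal property of the free act, specialized to \<open>\<langle>id, f\<rangle>\<close>: equations between
  endomorphisms of \<open>F\<^sub>M C\<close> need only be checked on the unit.\<close>

lemma E_map_eq_iff:
  assumes f: "f \<in> Hom \<C> C (Carr M)"
  shows "k \<in> Hom (Acts \<C> M) (Free_act \<C> M C) (Free_act \<C> M C) \<and>
      underlying k \<cdot> Free_unit \<C> M C = Tuple \<C> (Id \<C> C) f \<longleftrightarrow> k = E_map \<C> M C f"
proof -
  have C: "C \<in> Obj \<C>" using HomD[OF f] by simp
  have "\<exists>!k. k \<in> Hom (Acts \<C> M) (Free_act \<C> M C) (Free_act \<C> M C) \<and>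
      underlying k \<cdot> Free_unit \<C> M C = Tuple \<C> (Id \<C> C) f"
    using Sharp_unique_existence[OF C C Tuple_Hom[OF Id_Hom[OF C] f]] .
  from theI'[OF this] this show ?thesis unfolding E_map_def Sharp_def by blast
qed

lemma E_map_Hom:
  assumes "f \<in> Hom \<C> C (Carr M)"
  shows "E_map \<C> M C f \<in> Hom (Acts \<C> M) (Free_act \<C> M C) (Free_act \<C> M C)"
  using E_map_eq_iff[OF assms] by blast

lemma underlying_E_map_Free_unit:
  assumes "f \<in> Hom \<C> C (Carr M)"
  shows "underlying (E_map \<C> M C f) \<cdot> Free_unit \<C> M C = Tuple \<C> (Id \<C> C) f"
  using E_map_eq_iff[OF assms] by blast

lemma underlying_Hom:
  assumes "k \<in> Hom (Acts \<C> M) (A, \<alpha>) (B, \<beta>)"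
  shows "underlying k \<in> Hom \<C> A B"
  using assms by (auto simp: Hom_Acts is_act_morphism_def)

lemma underlying_End_Hom:
  assumes "k \<in> Hom (Acts \<C> M) (Free_act \<C> M C) (Free_act \<C> M C)"
  shows "underlying k \<in> Hom \<C> (C \<^bold>\<times> Carr M) (C \<^bold>\<times> Carr M)"
  using assms underlying_Hom unfolding Free_act_def by blast

lemma Free_unit_Hom:
  assumes C: "C \<in> Obj \<C>"
  shows "Free_unit \<C> M C \<in> Hom \<C> C (C \<^bold>\<times> Carr M)"
  using Tuple_Hom[OF Id_Hom[OF C] unt_el[OF C]] Free_unit_eq[OF C] by simp

text \<open>The image \<open>(c, f(c))\<close> of \<open>c\<close> under \<open>\<langle>id, f\<rangle>\<close> is acted on by \<open>x\<close>, and \<open>M\<close> acts on the free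
  act by right multiplication on the second component. For \<open>c = id\<close> this computes composites of
  values of \<open>E_map\<close> on the unit.\<close>

lemma underlying_E_map_Tuple:
  assumes f: "f \<in> Hom \<C> C (Carr M)" and c: "c \<in> Hom \<C> X C" and x: "x \<in> Hom \<C> X (Carr M)"
  shows "underlying (E_map \<C> M C f) \<cdot> Tuple \<C> c x = Tuple \<C> c (Mul M \<cdot> Tuple \<C> (f \<cdot> c) x)"
proof -
  have C: "C \<in> Obj \<C>" using HomD[OF f] by simp
  note M = Carr_Obj
  note g = Tuple_Hom[OF Id_Hom[OF C] f]
  let ?\<gamma> = "(Id \<C> C \<boxtimes> Mul M) \<cdot> Assoc \<C> C (Carr M) (Carr M)"
  have \<gamma>: "?\<gamma> \<in> Hom \<C> ((C \<^bold>\<times> Carr M) \<^bold>\<times> Carr M) (C \<^bold>\<times> Carr M)"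
    using Comp_Hom[OF Assoc_Hom[OF C M M] Times_Hom[OF Id_Hom[OF C] Mul_Hom]] .
  have "underlying (E_map \<C> M C f) \<cdot> Tuple \<C> c x =
      ?\<gamma> \<cdot> (Tuple \<C> (Id \<C> C) f \<boxtimes> Id \<C> (Carr M)) \<cdot> Tuple \<C> c x"
    using Comp_assoc[OF Tuple_Hom[OF c x] Times_Hom[OF g Id_Hom[OF M]] \<gamma>]
    by (simp add: E_map_def Sharp_eq[OF C C g])
  also have "\<dots> = ?\<gamma> \<cdot> Tuple \<C> (Tuple \<C> c (f \<cdot> c)) x"
    using Times_Tuple[OF g Id_Hom[OF M] c x] Tuple_Comp[OF Id_Hom[OF C] f c]
      Id_left[OF c] Id_left[OF x] by simp
  also have "\<dots> = Tuple \<C> c (Mul M \<cdot> Tuple \<C> (f \<cdot> c) x)"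
    using Free_act_Tuple[OF c Comp_Hom[OF c f] x] by (simp add: Free_act_def)
  finally show ?thesis .
qed

lemma E_map_Conv_one:
  assumes C: "C \<in> Obj \<C>"
  shows "E_map \<C> M C (Unt M \<cdot> Bang \<C> C) = Id (Acts \<C> M) (Free_act \<C> M C)"
proof -
  have "Id (Acts \<C> M) (Free_act \<C> M C) \<in> Hom (Acts \<C> M) (Free_act \<C> M C) (Free_act \<C> M C)"
    using category.Id_Hom[OF category_Acts] Free_act_is_act[OF C] by (simp add: Acts_def)
  moreover have "underlying (Id (Acts \<C> M) (Free_act \<C> M C)) \<cdot> Free_unit \<C> M C =
      Tuple \<C> (Id \<C> C) (Unt M \<cdot> Bang \<C> C)"
    using Id_left[OF Free_unit_Hom[OF C]] Free_unit_eq[OF C] by (simp add: Acts_def Free_act_def)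
  ultimately show ?thesis using E_map_eq_iff[OF unt_el[OF C]] by metis
qed

lemma E_map_Conv_mult:
  assumes \<phi>: "\<phi> \<in> Hom \<C> C (Carr M)" and \<psi>: "\<psi> \<in> Hom \<C> C (Carr M)"
  shows "E_map \<C> M C (Mul M \<cdot> Tuple \<C> \<phi> \<psi>) = E_map \<C> M C \<phi> \<cdot>\<^bsub>Acts \<C> M\<^esub> E_map \<C> M C \<psi>"
proof -
  have C: "C \<in> Obj \<C>" using HomD[OF \<phi>] by simp
  let ?k = "E_map \<C> M C \<phi> \<cdot>\<^bsub>Acts \<C> M\<^esub> E_map \<C> M C \<psi>"
  have "?k \<in> Hom (Acts \<C> M) (Free_act \<C> M C) (Free_act \<C> M C)"
    using category.Comp_Hom[OF category_Acts E_map_Hom[OF \<psi>] E_map_Hom[OF \<phi>]] .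
  moreover have "underlying ?k \<cdot> Free_unit \<C> M C = Tuple \<C> (Id \<C> C) (Mul M \<cdot> Tuple \<C> \<phi> \<psi>)"
  proof -
    have "underlying ?k = underlying (E_map \<C> M C \<phi>) \<cdot> underlying (E_map \<C> M C \<psi>)"
      by (simp add: Acts_def case_prod_beta)
    then have "underlying ?k \<cdot> Free_unit \<C> M C =
        underlying (E_map \<C> M C \<phi>) \<cdot> Tuple \<C> (Id \<C> C) \<psi>"
      using Comp_assoc[OF Free_unit_Hom[OF C] underlying_End_Hom[OF E_map_Hom[OF \<psi>]]
          underlying_End_Hom[OF E_map_Hom[OF \<phi>]]] underlying_E_map_Free_unit[OF \<psi>] by simp
    also have "\<dots> = Tuple \<C> (Id \<C> C) (Mul M \<cdot> Tuple \<C> \<phi> \<psi>)"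
      using underlying_E_map_Tuple[OF \<phi> Id_Hom[OF C] \<psi>] Id_right[OF \<phi>] by simp
    finally show ?thesis .
  qed
  ultimately show ?thesis using E_map_eq_iff[OF mul_el[OF \<phi> \<psi>]] by metis
qed

lemma monoid_morphism_E_map:
  assumes C: "C \<in> Obj \<C>"
  shows "monoid_morphism (Conv_monoid \<C> M C) (End_monoid (Acts \<C> M) (Free_act \<C> M C)) (E_map \<C> M C)"
proof -
  have "Free_act \<C> M C \<in> Obj (Acts \<C> M)" using Free_act_is_act[OF C] by (simp add: Acts_def)
  then have "monoid (End_monoid (Acts \<C> M) (Free_act \<C> M C))"
    using category.monoid_End_monoid[OF category_Acts] by blast
  moreover have "E_map \<C> M C \<in> hom (Conv_monoid \<C> M C) (End_monoid (Acts \<C> M) (Free_act \<C> M C))"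
  proof (rule homI)
    fix \<phi> assume "\<phi> \<in> carrier (Conv_monoid \<C> M C)"
    then have \<phi>: "\<phi> \<in> Hom \<C> C (Carr M)" by (simp add: Conv_monoid_def)
    show "E_map \<C> M C \<phi> \<in> carrier (End_monoid (Acts \<C> M) (Free_act \<C> M C))"
      using E_map_Hom[OF \<phi>] by (simp add: End_monoid_def)
    fix \<psi> assume "\<psi> \<in> carrier (Conv_monoid \<C> M C)"
    then have \<psi>: "\<psi> \<in> Hom \<C> C (Carr M)" by (simp add: Conv_monoid_def)
    show "E_map \<C> M C (\<phi> \<otimes>\<^bsub>Conv_monoid \<C> M C\<^esub> \<psi>) =
        E_map \<C> M C \<phi> \<otimes>\<^bsub>End_monoid (Acts \<C> M) (Free_act \<C> M C)\<^esub> E_map \<C> M C \<psi>"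
      unfolding Conv_mult_eq[OF \<phi> \<psi>] E_map_Conv_mult[OF \<phi> \<psi>] by (simp add: End_monoid_def)
  qed
  moreover have "E_map \<C> M C \<one>\<^bsub>Conv_monoid \<C> M C\<^esub> = \<one>\<^bsub>End_monoid (Acts \<C> M) (Free_act \<C> M C)\<^esub>"
    using E_map_Conv_one[OF C] by (simp add: Conv_monoid_def End_monoid_def)
  ultimately show ?thesis using monoid_Conv_monoid[OF C] by (simp add: monoid_morphism_def)
qed

text \<open>The retraction restricts an endomorphism along the unit and keeps the \<open>M\<close>-component.\<close>

lemma E_map_left_inverse:
  assumes C: "C \<in> Obj \<C>"
  shows "\<exists>R \<in> Hom (Acts \<C> M) (Free_act \<C> M C) (Free_act \<C> M C) \<rightarrow> Hom \<C> C (Carr M).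
    \<forall>f \<in> Hom \<C> C (Carr M). R (E_map \<C> M C f) = f"
proof (intro bexI ballI funcsetI)
  let ?R = "\<lambda>k. Snd \<C> C (Carr M) \<cdot> underlying k \<cdot> Free_unit \<C> M C"
  show "?R k \<in> Hom \<C> C (Carr M)"
    if "k \<in> Hom (Acts \<C> M) (Free_act \<C> M C) (Free_act \<C> M C)" for k
    using Comp_Hom[OF Comp_Hom[OF Free_unit_Hom[OF C] underlying_End_Hom[OF that]]
        Snd_Hom[OF C Carr_Obj]] .
  show "?R (E_map \<C> M C f) = f" if f: "f \<in> Hom \<C> C (Carr M)" for f
    using Snd_Tuple[OF Id_Hom[OF C] f] underlying_E_map_Free_unit[OF f] by simp
qed

end

text \<open>The two inverse laws, which are equations between arrows \<open>M \<rightarrow> M\<close>, are pulled back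
  along \<open>f\<close>; the inverse of \<open>f\<close> is its composite with the inversion of \<open>M\<close>.\<close>

lemma (in group_object) Conv_inverse:
  assumes f: "f \<in> Hom \<C> C (Carr M)"
  shows "\<exists>g \<in> Hom \<C> C (Carr M). g \<otimes>\<^bsub>Conv_monoid \<C> M C\<^esub> f = \<one>\<^bsub>Conv_monoid \<C> M C\<^esub> \<and>
    f \<otimes>\<^bsub>Conv_monoid \<C> M C\<^esub> g = \<one>\<^bsub>Conv_monoid \<C> M C\<^esub>"
proof -
  note I = Id_Hom[OF Carr_Obj]
  obtain i where i: "i \<in> Hom \<C> (Carr M) (Carr M)"
    and "Mul M \<cdot> (i \<boxtimes> Id \<C> (Carr M)) \<cdot> Diag \<C> (Carr M) = Unt M \<cdot> Bang \<C> (Carr M)"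
    and "Mul M \<cdot> (Id \<C> (Carr M) \<boxtimes> i) \<cdot> Diag \<C> (Carr M) = Unt M \<cdot> Bang \<C> (Carr M)"
    using inverse by blast
  then have l: "Mul M \<cdot> Tuple \<C> i (Id \<C> (Carr M)) = Unt M \<cdot> Bang \<C> (Carr M)"
    and r: "Mul M \<cdot> Tuple \<C> (Id \<C> (Carr M)) i = Unt M \<cdot> Bang \<C> (Carr M)"
    using Times_Tuple[OF i I I I] Times_Tuple[OF I i I I] Id_right[OF i] Id_left[OF I]
    by (simp_all add: Diag_def)
  note inv_f = Comp_Hom[OF f i]
  have "Mul M \<cdot> Tuple \<C> (i \<cdot> f) f = Unt M \<cdot> Bang \<C> C" "Mul M \<cdot> Tuple \<C> f (i \<cdot> f) = Unt M \<cdot> Bang \<C> C"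
    using mul_Comp[OF i I f] mul_Comp[OF I i f] unt_Comp[OF f] Id_left[OF f] l r by simp_all
  then have "(i \<cdot> f) \<otimes>\<^bsub>Conv_monoid \<C> M C\<^esub> f = \<one>\<^bsub>Conv_monoid \<C> M C\<^esub>"
      "f \<otimes>\<^bsub>Conv_monoid \<C> M C\<^esub> (i \<cdot> f) = \<one>\<^bsub>Conv_monoid \<C> M C\<^esub>"
    unfolding Conv_mult_eq[OF inv_f f] Conv_mult_eq[OF f inv_f] by (simp_all add: Conv_monoid_def)
  then show ?thesis using inv_f by blast
qed

theorem proposition1:
  fixes \<C> :: "('o, 'm, 'z) fp_category_scheme"
    and M :: "('o, 'm) monoid_object"
    and C :: 'o
  assumes "fp_category \<C>"
    and "monoid_object \<C> M"
    and "C \<in> Obj \<C>"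
  shows "E_map \<C> M C \<in> Hom \<C> C (Carr M) \<rightarrow> Hom (Acts \<C> M) (Free_act \<C> M C) (Free_act \<C> M C)
    \<and> monoid_morphism (Conv_monoid \<C> M C) (End_monoid (Acts \<C> M) (Free_act \<C> M C)) (E_map \<C> M C)
    \<and> (\<exists>R \<in> Hom (Acts \<C> M) (Free_act \<C> M C) (Free_act \<C> M C) \<rightarrow> Hom \<C> C (Carr M).
        \<forall>f \<in> Hom \<C> C (Carr M). R (E_map \<C> M C f) = f)
    \<and> (group_object \<C> M \<longrightarrow>
        (\<forall>f \<in> Hom \<C> C (Carr M). automorphism (Acts \<C> M) (Free_act \<C> M C) (E_map \<C> M C f)))"
proof -
  interpret monoid_object \<C> M by fact
  note C = \<open>C \<in> Obj \<C>\<close>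
  have "automorphism (Acts \<C> M) (Free_act \<C> M C) (E_map \<C> M C f)"
    if G: "group_object \<C> M" and f: "f \<in> Hom \<C> C (Carr M)" for f
  proof -
    obtain g where "g \<in> Hom \<C> C (Carr M)"
      "g \<otimes>\<^bsub>Conv_monoid \<C> M C\<^esub> f = \<one>\<^bsub>Conv_monoid \<C> M C\<^esub>"
      "f \<otimes>\<^bsub>Conv_monoid \<C> M C\<^esub> g = \<one>\<^bsub>Conv_monoid \<C> M C\<^esub>"
      using group_object.Conv_inverse[OF G f] by blast
    moreover have "carrier (Conv_monoid \<C> M C) = Hom \<C> C (Carr M)"
      by (simp add: Conv_monoid_def)
    ultimately show ?thesis
      using automorphism_if_monoid_morphism[OF monoid_morphism_E_map[OF C]] f by simp
  qed
  then show ?thesis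
    using E_map_Hom monoid_morphism_E_map[OF C] E_map_left_inverse[OF C] by blast
qed

end
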